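(* Let $V_g>0$, $k_G>0$, $e_0\in\mathbb{R}$, and let $e(t)$, $t\ge 0$, be the solution of $$\dot e=-V_g\tanh(k_G e),\qquad e(0)=e_0.$$ For $\varepsilon>0$ define the tube-entry time $$T_\varepsilon:=\inf\{t\ge 0:\ |e(t)|\le\varepsilon\}.$$ If $|e_0|>\varepsilon$, then $$T_\varepsilon=\frac{1}{k_G V_g}\,\ln\!\left(\frac{\sinh(k_G|e_0|)}{\sinh(k_G\varepsilon)}\right).$$ If $|e_0|\le\varepsilon$, then $T_\varepsilon=0$.
   Context: Here $e$ is the standoff error of a vehicle relative to a desired curve, $V_g$ is its constant ground speed, and $k_G$ is a guidance gain. *)

theory Defs
  imports "HOL-Analysis.Analysis"
begin

text \<open>
  Solutions live on the half-line \<open>t \<ge> 0\<close>: the derivative at \<open>t = 0\<close> is one-sided, and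
  the values of \<open>e\<close> at negative arguments are irrelevant.
\<close>

definition standoff_error_solution :: "real \<Rightarrow> real \<Rightarrow> real \<Rightarrow> (real \<Rightarrow> real) \<Rightarrow> bool" where
  "standoff_error_solution Vg kG e0 e \<longleftrightarrow>
     e 0 = e0 \<and>
     (\<forall>t\<ge>0. (e has_real_derivative - Vg * tanh (kG * e t)) (at t within {0..}))"

text \<open>
  The infimum is taken in the extended reals, so that it is \<open>\<infinity>\<close> if the tube is never
  entered; the infimum of the empty set of type \<^typ>\<open>real\<close> would be an unspecified number.
\<close>

definition tube_entry_time :: "(real \<Rightarrow> real) \<Rightarrow> real \<Rightarrow> ereal" where
  "tube_entry_time e \<epsilon> = (INF t \<in> {t. 0 \<le> t \<and> \<bar>e t\<bar> \<le> \<epsilon>}. ereal t)"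

end

theory Submission
  imports Defs
begin

text \<open>
  The substitution \<open>s = sinh (kG * e)\<close> linearises the equation to \<open>s' = - kG * Vg * s\<close>, so that
  \<open>sinh (kG * e t) = exp (- kG * Vg * t) * sinh (kG * e0)\<close>. Since \<open>sinh\<close> is odd and strictly
  increasing, \<open>\<bar>e t\<bar> \<le> \<epsilon>\<close> holds exactly from the claimed time onwards.
\<close>

lemma sinh_standoff_error:
  assumes "standoff_error_solution Vg kG e0 e" and "t \<ge> 0"
  shows "sinh (kG * e t) = exp (- (kG * Vg * t)) * sinh (kG * e0)"
proof -
  \<comment> \<open>The integrating factor \<open>exp (kG * Vg * t)\<close> turns the linear
    equation for \<open>sinh (kG * e t)\<close> into the constancy of \<open>?g\<close>.\<close>
  let ?g = "\<lambda>t. exp (kG * Vg * t) * sinh (kG * e t)"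
  have "(?g has_real_derivative 0) (at u within {0..})" if "u \<in> {0..}" for u
  proof -
    have e: "(e has_real_derivative - Vg * tanh (kG * e u)) (at u within {0..})"
      using assms(1) that by (simp add: standoff_error_solution_def)
    \<comment> \<open>The two terms of the derivative cancel through
      \<open>cosh x * tanh x = sinh x\<close>, which divides by \<open>cosh x\<close>.\<close>
    have "cosh (kG * e u) \<noteq> 0"
      using cosh_real_pos[of "kG * e u"] by linarith
    then show ?thesis
      by (auto intro!: derivative_eq_intros e simp: tanh_def field_simps)
  qed
  then obtain c where c: "\<And>u. u \<in> {0..} \<Longrightarrow> ?g u = c"
    using has_field_derivative_zero_constant[of "{0..}" ?g] by auto
  have "?g t = ?g 0"
    using c[of t] c[of 0] assms(2) by simp
  then show ?thesis
    using assms(1) by (simp add: standoff_error_solution_def exp_minus field_simps)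
qed

text \<open>Taking logarithms in the closed form isolates \<open>t\<close>;
  \<open>e0 \<noteq> 0\<close> makes the argument of \<open>ln\<close> positive. The threshold is
  negative when \<open>\<bar>e0\<bar> < \<epsilon>\<close>, and both sides then hold for every
  \<open>t \<ge> 0\<close>.\<close>

lemma abs_standoff_error_le_iff:
  assumes "Vg > 0" and "kG > 0" and "standoff_error_solution Vg kG e0 e"
    and "\<epsilon> > 0" and "e0 \<noteq> 0" and "t \<ge> 0"
  shows "\<bar>e t\<bar> \<le> \<epsilon> \<longleftrightarrow> 1 / (kG * Vg) * ln (sinh (kG * \<bar>e0\<bar>) / sinh (kG * \<epsilon>)) \<le> t"
proof -
  have pos: "sinh (kG * \<bar>e0\<bar>) > 0" "sinh (kG * \<epsilon>) > 0" "kG * Vg > 0"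
    using assms by simp_all
  \<comment> \<open>This passes from the signed closed form to absolute values without a case split
    on the sign of \<open>e0\<close>.\<close>
  have sinh_abs: "sinh (kG * \<bar>x\<bar>) = \<bar>sinh (kG * x)\<bar>" for x
    using assms(2) sinh_real_abs[of "kG * x"] by (simp add: abs_mult)
  have "\<bar>e t\<bar> \<le> \<epsilon> \<longleftrightarrow> sinh (kG * \<bar>e t\<bar>) \<le> sinh (kG * \<epsilon>)"
    using assms(2) by simp
  also have "sinh (kG * \<bar>e t\<bar>) = exp (- (kG * Vg * t)) * sinh (kG * \<bar>e0\<bar>)"
    using sinh_standoff_error[OF assms(3,6)] by (simp add: sinh_abs abs_mult)
  also have "\<dots> \<le> sinh (kG * \<epsilon>) \<longleftrightarrow> sinh (kG * \<bar>e0\<bar>) / sinh (kG * \<epsilon>) \<le> exp (kG * Vg * t)"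
    using pos by (simp add: exp_minus field_simps)
  also have "\<dots> \<longleftrightarrow> ln (sinh (kG * \<bar>e0\<bar>) / sinh (kG * \<epsilon>)) \<le> kG * Vg * t"
    using pos ln_le_cancel_iff[of "sinh (kG * \<bar>e0\<bar>) / sinh (kG * \<epsilon>)" "exp (kG * Vg * t)"] by simp
  also have "\<dots> \<longleftrightarrow> 1 / (kG * Vg) * ln (sinh (kG * \<bar>e0\<bar>) / sinh (kG * \<epsilon>)) \<le> t"
    using pos(3) by (simp add: pos_divide_le_eq mult.commute)
  finally show ?thesis .
qed

theorem theorem3:
  fixes Vg kG e0 \<epsilon> :: real and e :: "real \<Rightarrow> real"
  assumes "Vg > 0" and "kG > 0"
    and "standoff_error_solution Vg kG e0 e"
    and "\<epsilon> > 0"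
  shows "(\<bar>e0\<bar> > \<epsilon> \<longrightarrow>
            tube_entry_time e \<epsilon> =
              ereal (1 / (kG * Vg) * ln (sinh (kG * \<bar>e0\<bar>) / sinh (kG * \<epsilon>))))
       \<and> (\<bar>e0\<bar> \<le> \<epsilon> \<longrightarrow> tube_entry_time e \<epsilon> = 0)"
proof (intro conjI impI)
  assume "\<bar>e0\<bar> > \<epsilon>"
  let ?T = "1 / (kG * Vg) * ln (sinh (kG * \<bar>e0\<bar>) / sinh (kG * \<epsilon>))"
  have "e0 \<noteq> 0"
    using \<open>\<bar>e0\<bar> > \<epsilon>\<close> assms(4) by auto
  note iff = abs_standoff_error_le_iff[OF assms this]
  have "\<not> \<bar>e 0\<bar> \<le> \<epsilon>"
    using \<open>\<bar>e0\<bar> > \<epsilon>\<close> assms(3) by (simp add: standoff_error_solution_def)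
  \<comment> \<open>The equivalence at time 0 gives the sign of \<open>?T\<close>, so that the
    constraint \<open>0 \<le> t\<close> cuts nothing off the ray \<open>{?T..}\<close>.\<close>
  then have "?T \<ge> 0"
    using iff[of 0] by linarith
  then have "{t. 0 \<le> t \<and> \<bar>e t\<bar> \<le> \<epsilon>} = {?T..}"
    using iff by force
  then show "tube_entry_time e \<epsilon> = ereal ?T"
    unfolding tube_entry_time_def by (auto intro!: antisym INF_lower INF_greatest)
next
  assume "\<bar>e0\<bar> \<le> \<epsilon>"
  then have "0 \<in> {t. 0 \<le> t \<and> \<bar>e t\<bar> \<le> \<epsilon>}"
    using assms(3) by (simp add: standoff_error_solution_def)
  then show "tube_entry_time e \<epsilon> = 0"
    unfolding tube_entry_time_def
    by (intro antisym INF_greatest) (auto intro: INF_lower2 simp: zero_ereal_def)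
qed

end
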